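(* Let $a\in\mathbb N$. There exist polynomials $P_{a,\ell,n}(x)$ (for $\ell\in\mathbb N_0$, $n\in\mathbb N$) and $P_{a,\ell,m,n}(x)$ (for $\ell\in\mathbb N_0$, $m,n\in\mathbb N$), each of degree at most $\ell$, such that for all $k\in\mathbb Z$ and $r,s\in\mathbb N$, $$\mathcal A_{a,k,r}(q)=\sum_{\ell\ge0}\ \sum_{n\ge\frac{a(a+1)}2}P_{a,\ell,n}(k)\,q^{nr+\ell},\qquad \mathcal B_{a,k,r,s}(q)=\sum_{\ell\ge0}\ \sum_{n\ge\frac{a(a+1)}2}\ \sum_{\frac{n^2}{a}\le m\le n^2}P_{a,\ell,m,n}(k)\,q^{mr+ns+\ell}.$$
   Context: For $a,r,s\in\mathbb N$ and $k\in\mathbb Z$ define $$\mathcal A_{a,k,r}(q):=\sum_{1\le n_1<\dots<n_a}\frac{q^{r(n_1+\dots+n_a)}}{(1-q^{n_1})^k\cdots(1-q^{n_a})^k},\qquad \mathcal B_{a,k,r,s}(q):=\sum_{1\le n_1<\dots<n_a}\frac{q^{r(n_1^2+\dots+n_a^2)+s(n_1+\dots+n_a)}}{(1-q^{n_1})^k\cdots(1-q^{n_a})^k},$$ viewed as formal power series in $q$. The polynomials $P_{a,\ell,n}$, $P_{a,\ell,m,n}$ do not depend on $k,r,s$. *)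

theory Defs
  imports "HOL-Analysis.Analysis"
begin

text \<open>
  Infinite sums of formal power series are taken with respect to the library's topology on
  \<^typ>\<open>'a fps\<close>, in which convergence means that every coefficient is eventually constant.
  The library's \<^const>\<open>infsum\<close> is \<open>0\<close> for non-summable families; the lemmas
  \<open>A_term_summable\<close> and \<open>B_term_summable\<close> below show that this convention never applies for
  \<open>r \<ge> 1\<close> and \<open>s \<ge> 1\<close>.
\<close>

text \<open>The index set \<open>1 \<le> n\<^sub>1 < \<dots> < n\<^sub>a\<close>; a tuple is represented by a list.\<close>

definition incr_tuples :: "nat \<Rightarrow> nat list set" where
  "incr_tuples a = {ns. length ns = a \<and> sorted_wrt (<) ns \<and> (\<forall>n\<in>set ns. 1 \<le> n)}"

definition denom :: "int \<Rightarrow> nat list \<Rightarrow> 'a::field_char_0 fps" where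
  "denom k ns = (\<Prod>n\<leftarrow>ns. (1 - fps_X ^ n) powi k)"

definition A_term :: "int \<Rightarrow> nat \<Rightarrow> nat list \<Rightarrow> 'a::field_char_0 fps" where
  "A_term k r ns = fps_X ^ (r * (\<Sum>n\<leftarrow>ns. n)) / denom k ns"

definition B_term :: "int \<Rightarrow> nat \<Rightarrow> nat \<Rightarrow> nat list \<Rightarrow> 'a::field_char_0 fps" where
  "B_term k r s ns = fps_X ^ (r * (\<Sum>n\<leftarrow>ns. n\<^sup>2) + s * (\<Sum>n\<leftarrow>ns. n)) / denom k ns"

definition A_series :: "nat \<Rightarrow> int \<Rightarrow> nat \<Rightarrow> 'a::field_char_0 fps" where
  "A_series a k r = (\<Sum>\<^sub>\<infinity>ns\<in>incr_tuples a. A_term k r ns)"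

definition B_series :: "nat \<Rightarrow> int \<Rightarrow> nat \<Rightarrow> nat \<Rightarrow> 'a::field_char_0 fps" where
  "B_series a k r s = (\<Sum>\<^sub>\<infinity>ns\<in>incr_tuples a. B_term k r s ns)"

lemma fps_summable_onI:
  fixes f :: "'b \<Rightarrow> 'a::field_char_0 fps"
  assumes fin: "\<And>i. finite {x\<in>S. fps_nth (f x) i \<noteq> 0}"
  shows "f summable_on S"
proof -
  define g where "g = Abs_fps (\<lambda>i. \<Sum>x | x \<in> S \<and> fps_nth (f x) i \<noteq> 0. fps_nth (f x) i)"
  have "(sum f \<longlongrightarrow> g) (finite_subsets_at_top S)"
  proof (rule tendsto_fpsI)
    fix i
    show "eventually (\<lambda>F. fps_nth (sum f F) i = fps_nth g i) (finite_subsets_at_top S)"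
      unfolding eventually_finite_subsets_at_top
    proof (intro exI[of _ "{x\<in>S. fps_nth (f x) i \<noteq> 0}"] conjI allI impI)
      fix F assume F: "finite F \<and> {x\<in>S. fps_nth (f x) i \<noteq> 0} \<subseteq> F \<and> F \<subseteq> S"
      have "(\<Sum>x\<in>F. fps_nth (f x) i) = (\<Sum>x | x \<in> S \<and> fps_nth (f x) i \<noteq> 0. fps_nth (f x) i)"
        by (rule sum.mono_neutral_right) (use F in auto)
      then show "fps_nth (sum f F) i = fps_nth g i"
        by (simp add: g_def fps_sum_nth)
    qed (use fin in auto)
  qed
  then show ?thesis
    unfolding summable_on_def has_sum_def by blast
qed

lemma denom_nth_0:
  assumes "\<forall>n\<in>set ns. 1 \<le> n"
  shows "fps_nth (denom k ns :: 'a::field_char_0 fps) 0 = 1"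
  using assms
proof (induction ns)
  case (Cons n ns)
  have "fps_nth ((1 - fps_X ^ n :: 'a fps) powi k) 0 = 1"
    using Cons.prems by (auto simp: power_int_def fps_nth_power_0 power_0_left)
  with Cons show ?case by (auto simp: denom_def)
qed (auto simp: denom_def)

lemma X_power_quotient_summable:
  fixes e :: "nat list \<Rightarrow> nat"
  assumes e: "\<And>ns. ns \<in> incr_tuples a \<Longrightarrow> sum_list ns \<le> e ns"
  shows "(\<lambda>ns. fps_X ^ e ns / denom k ns :: 'a::field_char_0 fps) summable_on incr_tuples a"
proof (rule fps_summable_onI)
  fix i
  have "ns \<in> {ns. set ns \<subseteq> {..i} \<and> length ns = a}"
    if ns: "ns \<in> incr_tuples a" and nz: "fps_nth (fps_X ^ e ns / denom k ns :: 'a fps) i \<noteq> 0" for ns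
  proof -
    have "fps_nth (denom k ns :: 'a fps) 0 \<noteq> 0"
      using ns denom_nth_0[of ns k, where 'a = 'a] by (simp add: incr_tuples_def)
    then have "fps_X ^ e ns / denom k ns = fps_X ^ e ns * inverse (denom k ns :: 'a fps)"
      by (rule fps_divide_unit)
    with nz have "e ns \<le> i"
      by (auto simp: fps_X_power_mult_nth split: if_splits)
    then have "sum_list ns \<le> i" using e[OF ns] by simp
    then show ?thesis
      using ns member_le_sum_list[of _ ns] by (force simp: incr_tuples_def)
  qed
  then show "finite {ns \<in> incr_tuples a. fps_nth (fps_X ^ e ns / denom k ns :: 'a fps) i \<noteq> 0}"
    by (intro finite_subset[OF _ finite_lists_length_eq[of "{..i}" a]]) auto
qed

lemma A_term_summable:
  assumes "1 \<le> r"
  shows "(A_term k r :: _ \<Rightarrow> 'a::field_char_0 fps) summable_on incr_tuples a"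
  unfolding A_term_def[abs_def]
  by (rule X_power_quotient_summable) (use assms in simp)

lemma B_term_summable:
  assumes "1 \<le> s"
  shows "(B_term k r s :: _ \<Rightarrow> 'a::field_char_0 fps) summable_on incr_tuples a"
  unfolding B_term_def[abs_def]
  by (rule X_power_quotient_summable) (use assms in \<open>simp add: trans_le_add2\<close>)

end

theory Submission
  imports Defs
begin

text \<open>
  Writing \<open>D = \<Prod>(1 - q\<^bsup>n\<^sub>i\<^esup>)\<close>, the coefficient of \<open>q\<^sup>l\<close> in \<open>D\<^bsup>-k\<^esup> = (1 + (D - 1))\<^bsup>-k\<^esup>\<close> is
  \<open>\<Sum>j\<le>l. binomial(-k, j) * [q\<^sup>l] (D - 1)\<^sup>j\<close> because \<open>D - 1\<close> has no constant term; this is a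
  polynomial in \<open>k\<close> of degree at most \<open>l\<close>. Summing these polynomials over the finitely many tuples
  with prescribed \<open>\<Sum>n\<^sub>i\<close> (and \<open>\<Sum>n\<^sub>i\<^sup>2\<close>) gives the claim; the ranges of \<open>n\<close> and \<open>m\<close> come from
  \<open>n\<^sub>i \<ge> i\<close> and from the Cauchy-Schwarz inequality.
\<close>

section \<open>Summation and regrouping of formal power series\<close>

lemma fps_has_sumI:
  fixes f :: "'b \<Rightarrow> 'a::field_char_0 fps"
  assumes "\<And>i. finite (F i)" and "\<And>i. F i \<subseteq> S"
    and zero: "\<And>i x. x \<in> S - F i \<Longrightarrow> fps_nth (f x) i = 0"
    and sum: "\<And>i. (\<Sum>x\<in>F i. fps_nth (f x) i) = fps_nth g i"
  shows "(f has_sum g) S"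
  unfolding has_sum_def
proof (rule tendsto_fpsI)
  fix i
  show "eventually (\<lambda>E. fps_nth (sum f E) i = fps_nth g i) (finite_subsets_at_top S)"
    unfolding eventually_finite_subsets_at_top
  proof (intro exI[of _ "F i"] conjI allI impI)
    fix E assume E: "finite E \<and> F i \<subseteq> E \<and> E \<subseteq> S"
    have "(\<Sum>x\<in>E. fps_nth (f x) i) = (\<Sum>x\<in>F i. fps_nth (f x) i)"
      by (rule sum.mono_neutral_right) (use E zero in auto)
    then show "fps_nth (sum f E) i = fps_nth g i"
      by (simp add: fps_sum_nth sum)
  qed (use assms in auto)
qed

text \<open>Both sums have the same coefficient of \<open>q^i\<close>, a sum over the finitely many
  \<open>x\<close> with \<open>e (w x) <= i\<close>. Each fibre of \<open>w\<close> is finite by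
  \<open>fin\<close> at \<open>i = e v\<close>, and a weight in \<open>K\<close> that no
  \<open>x\<close> attains contributes an empty sum.\<close>

lemma has_sum_group_by_weight:
  fixes G :: "'b \<Rightarrow> 'a::field_char_0 fps" and w :: "'b \<Rightarrow> 'c" and e :: "'c \<Rightarrow> nat"
  assumes fin: "\<And>i. finite {x\<in>T. e (w x) \<le> i}" and K: "w ` T \<subseteq> K"
  shows "((\<lambda>(l, v). fps_const (\<Sum>x | x \<in> T \<and> w x = v. fps_nth (G x) l) * fps_X ^ (e v + l))
          has_sum (\<Sum>\<^sub>\<infinity>x\<in>T. fps_X ^ e (w x) * G x)) (UNIV \<times> K)"
proof -
  define U where "U i = {x\<in>T. e (w x) \<le> i}" for i
  \<comment> \<open>This is the only index \<open>(l, v)\<close> through which \<open>x\<close>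
    contributes to the coefficient of \<open>q^i\<close>.\<close>
  define h where "h i x = (i - e (w x), w x)" for i x
  define g where "g = Abs_fps (\<lambda>i. \<Sum>x\<in>U i. fps_nth (G x) (i - e (w x)))"
  have finU: "finite (U i)" for i
    using fin by (simp add: U_def)
  have "((\<lambda>x. fps_X ^ e (w x) * G x) has_sum g) T"
    by (rule fps_has_sumI[where F = U])
      (auto simp: fin U_def g_def fps_X_power_mult_nth intro!: sum.cong)
  then have "(\<Sum>\<^sub>\<infinity>x\<in>T. fps_X ^ e (w x) * G x) = g"
    by (rule infsumI)
  moreover have "((\<lambda>(l, v). fps_const (\<Sum>x | x \<in> T \<and> w x = v. fps_nth (G x) l) *
      fps_X ^ (e v + l)) has_sum g) (UNIV \<times> K)"
  proof (rule fps_has_sumI[where F = "\<lambda>i. h i ` U i"])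
    fix i
    show "finite (h i ` U i)" by (simp add: finU)
    show "h i ` U i \<subseteq> UNIV \<times> K" using K by (auto simp: h_def U_def)
    show "fps_nth (case p of (l, v) \<Rightarrow> fps_const (\<Sum>x | x \<in> T \<and> w x = v. fps_nth (G x) l) *
      fps_X ^ (e v + l)) i = 0" if p: "p \<in> UNIV \<times> K - h i ` U i" for p
    proof (cases p)
      case (Pair l v)
      have "p \<in> h i ` U i" if "i = e v + l" "x \<in> T" "w x = v" for x
        using that by (intro image_eqI[of _ _ x]) (auto simp: Pair h_def U_def)
      with p have "{x. x \<in> T \<and> w x = v} = {}" if "i = e v + l"
        using that by blast
      then show ?thesis by (auto simp: Pair fps_X_power_nth intro!: sum.neutral)
    qed
    have "(\<Sum>p\<in>h i ` U i. fps_nth (case p of (l, v) \<Rightarrow>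
        fps_const (\<Sum>x | x \<in> T \<and> w x = v. fps_nth (G x) l) * fps_X ^ (e v + l)) i)
      = (\<Sum>p\<in>h i ` U i. \<Sum>x | x \<in> U i \<and> h i x = p. fps_nth (G x) (i - e (w x)))"
    proof (rule sum.cong[OF refl])
      fix p assume "p \<in> h i ` U i"
      then obtain y where y: "y \<in> T" "e (w y) \<le> i" "p = (i - e (w y), w y)"
        by (auto simp: U_def h_def)
      \<comment> \<open>The exponent depends on \<open>x\<close> only through \<open>w x\<close>, so
        a fibre of \<open>w\<close> lies in \<open>U i\<close> as soon as one of its points
        does.\<close>
      have "{x. x \<in> U i \<and> h i x = p} = {x. x \<in> T \<and> w x = w y}"
        using y by (auto simp: U_def h_def)
      then show "fps_nth (case p of (l, v) \<Rightarrow>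
          fps_const (\<Sum>x | x \<in> T \<and> w x = v. fps_nth (G x) l) * fps_X ^ (e v + l)) i
        = (\<Sum>x | x \<in> U i \<and> h i x = p. fps_nth (G x) (i - e (w x)))"
        using y by (auto simp: fps_X_power_nth intro!: sum.cong)
    qed
    also have "\<dots> = fps_nth g i"
      using sum.image_gen[OF finU, of "\<lambda>x. fps_nth (G x) (i - e (w x))" i "h i"]
      by (simp add: g_def)
    finally show "(\<Sum>p\<in>h i ` U i. fps_nth (case p of (l, v) \<Rightarrow>
        fps_const (\<Sum>x | x \<in> T \<and> w x = v. fps_nth (G x) l) * fps_X ^ (e v + l)) i) = fps_nth g i" .
  qed
  ultimately show ?thesis by simp
qed

section \<open>Coefficients of integer powers as polynomials in the exponent\<close>

definition gbinomial_minus_poly :: "nat \<Rightarrow> 'a::field_char_0 poly" where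
  "gbinomial_minus_poly j = smult (1 / fact j) (\<Prod>i<j. [:- of_nat i, -1:])"

lemma poly_gbinomial_minus_poly: "poly (gbinomial_minus_poly j) x = (- x) gchoose j"
  by (simp add: gbinomial_minus_poly_def gbinomial_prod_rev poly_prod atLeast0LessThan algebra_simps)

lemma degree_gbinomial_minus_poly: "degree (gbinomial_minus_poly j :: 'a::field_char_0 poly) \<le> j"
proof -
  have "degree (\<Prod>i<j. [:- of_nat i, -1 :: 'a:]) \<le> (\<Sum>i<j. degree [:- of_nat i, -1 :: 'a:])"
    by (rule order.trans[OF degree_prod_sum_le]) (auto simp: o_def)
  also have "\<dots> = j" by simp
  finally show ?thesis by (simp add: gbinomial_minus_poly_def)
qed

text \<open>Substitute \<open>D - 1\<close>, which has no constant term, for \<open>X\<close> in the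
  binomial series of \<open>(1 + X)^(-k)\<close>; composition commutes with powers and
  inverses.\<close>

lemma fps_binomial_compose_power_int:
  fixes D :: "'a::field_char_0 fps"
  assumes D: "fps_nth D 0 = 1"
  shows "fps_binomial (- of_int k) oo (D - 1) = inverse (D powi k)"
proof -
  have 0: "fps_nth (D - 1) 0 = 0" using D by simp
  have c: "(1 + fps_X) oo (D - 1) = D"
    using 0 by (simp add: fps_compose_add_distrib)
  show ?thesis
  proof (cases "k \<ge> 0")
    case True
    then obtain n where k: "k = int n" using nonneg_int_cases by blast
    show ?thesis
      by (simp add: k fps_binomial_minus_of_nat fps_inverse_compose[OF 0] fps_nth_power_0
          fps_compose_power[OF 0, symmetric] c)
  next
    case False
    define n where "n = nat (- k)"
    have k: "k = - int n" using False by (simp add: n_def)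
    have "inverse (inverse D ^ n) = D ^ n"
      using D by (simp add: fps_inverse_power)
    then show ?thesis
      using False
      by (simp add: k fps_binomial_of_nat fps_compose_power[OF 0, symmetric] c power_int_def)
  qed
qed

text \<open>For \<open>D\<close> with constant term 1 this is the coefficient of \<open>q^l\<close>
  in \<open>D^(-k)\<close> as a polynomial in \<open>k\<close>. Stopping at \<open>j = l\<close> is
  what bounds its degree.\<close>

definition inv_power_coeff :: "'a::field_char_0 fps \<Rightarrow> nat \<Rightarrow> 'a poly" where
  "inv_power_coeff D l = (\<Sum>j\<le>l. smult (fps_nth ((D - 1) ^ j) l) (gbinomial_minus_poly j))"

lemma degree_inv_power_coeff: "degree (inv_power_coeff D l) \<le> l"
  unfolding inv_power_coeff_def
  by (intro degree_sum_le) (auto intro: order.trans[OF degree_smult_le]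
      order.trans[OF degree_gbinomial_minus_poly])

lemma poly_inv_power_coeff:
  assumes "fps_nth D 0 = 1"
  shows "poly (inv_power_coeff D l) (of_int k) = fps_nth (inverse (D powi k)) l"
  by (simp add: inv_power_coeff_def poly_sum poly_gbinomial_minus_poly fps_compose_nth atMost_atLeast0
      mult.commute flip: fps_binomial_compose_power_int[OF assms])

text \<open>Isolates \<open>k\<close> as an exponent, leaving a base \<open>denom 1 ns\<close> free
  of \<open>k\<close>.\<close>

lemma denom_eq_power_int:
  "(denom k ns :: 'a::field_char_0 fps) = denom 1 ns powi k"
  by (induction ns) (auto simp: denom_def power_int_def fps_inverse_mult power_mult_distrib)

section \<open>Increasing tuples: bounds, finiteness and expansion\<close>

lemma incr_tuples_sum_lower:
  assumes "ns \<in> incr_tuples a"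
  shows "a * (a + 1) div 2 \<le> sum_list ns"
proof -
  \<comment> \<open>The lower bound \<open>b\<close> is kept general because the tail of a strictly
    increasing list satisfies it with \<open>Suc b\<close>; the form avoids division and
    subtraction.\<close>
  have "length ns * (length ns + 2 * b) \<le> 2 * sum_list ns + length ns"
    if "sorted_wrt (<) ns" "\<forall>n\<in>set ns. b \<le> n" for b :: nat and ns
    using that
  proof (induction ns arbitrary: b)
    case (Cons n ns)
    have "length ns * (length ns + 2 * Suc b) \<le> 2 * sum_list ns + length ns"
      using Cons.prems by (intro Cons.IH) (auto simp: Suc_le_eq intro: le_less_trans)
    with Cons.prems show ?case by (auto simp: algebra_simps)
  qed simp
  from this[of ns 1] assms show ?thesis
    by (auto simp: incr_tuples_def algebra_simps)
qed

lemma sum_list_squares_le: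
  "(\<Sum>n\<leftarrow>ns. n\<^sup>2) \<le> (sum_list ns)\<^sup>2" for ns :: "nat list"
  by (induction ns) (auto simp: power2_sum)

lemma sum_list_squared_le:
  "(sum_list ns)\<^sup>2 \<le> length ns * (\<Sum>n\<leftarrow>ns. n\<^sup>2)" for ns :: "nat list"
proof -
  \<comment> \<open>Cauchy-Schwarz against the constant vector 1, over the reals.\<close>
  have "(\<Sum>i<length ns. real (ns ! i))\<^sup>2 \<le> (\<Sum>i<length ns. (real (ns ! i))\<^sup>2) * length ns"
    using sum_squared_le_sum_of_squares[of "\<lambda>i. real (ns ! i)" "{..<length ns}"] by simp
  then have "real ((sum_list ns)\<^sup>2) \<le> real (length ns * (\<Sum>n\<leftarrow>ns. n\<^sup>2))"
    by (simp add: sum_list_sum_nth atLeast0LessThan mult.commute)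
  then show ?thesis by (simp only: of_nat_le_iff)
qed

lemma finite_incr_tuples_sum_le: "finite {ns \<in> incr_tuples a. sum_list ns \<le> i}"
proof (rule finite_subset)
  show "{ns \<in> incr_tuples a. sum_list ns \<le> i} \<subseteq> {ns. set ns \<subseteq> {..i} \<and> length ns = a}"
    using member_le_sum_list by (fastforce simp: incr_tuples_def)
qed (simp add: finite_lists_length_eq)

text \<open>Common source of both expansions. The polynomials depend on \<open>w\<close> but not on
  \<open>e\<close>, and \<open>r\<close> and \<open>s\<close> will enter only through
  \<open>e\<close>. The first assumption leaves finitely many tuples for each power of
  \<open>q\<close>.\<close>

lemma has_sum_incr_tuples:
  fixes w :: "nat list \<Rightarrow> 'c" and e :: "'c \<Rightarrow> nat"
  assumes e: "\<And>ns. ns \<in> incr_tuples a \<Longrightarrow> sum_list ns \<le> e (w ns)"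
    and K: "w ` incr_tuples a \<subseteq> K"
  shows "((\<lambda>(l, v). fps_const (poly (\<Sum>ns | ns \<in> incr_tuples a \<and> w ns = v.
            inv_power_coeff (denom 1 ns) l) (of_int k)) * fps_X ^ (e v + l))
          has_sum (\<Sum>\<^sub>\<infinity>ns\<in>incr_tuples a. fps_X ^ e (w ns) / denom k ns :: 'a::field_char_0 fps))
          (UNIV \<times> K)"
proof -
  have coeff: "poly (inv_power_coeff (denom 1 ns) l) (of_int k) =
      fps_nth (inverse (denom k ns :: 'a fps)) l" if "ns \<in> incr_tuples a" for ns l
    using that denom_eq_power_int[of k ns, where 'a = 'a]
    by (simp add: incr_tuples_def poly_inv_power_coeff denom_nth_0)
  \<comment> \<open>The constant term 1 makes \<open>denom k ns\<close> a unit.\<close>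
  have div: "fps_X ^ j / denom k ns = fps_X ^ j * inverse (denom k ns :: 'a fps)"
    if "ns \<in> incr_tuples a" for ns j
    using that denom_nth_0[of ns k, where 'a = 'a]
    by (intro fps_divide_unit) (simp add: incr_tuples_def)
  have "((\<lambda>(l, v). fps_const (\<Sum>ns | ns \<in> incr_tuples a \<and> w ns = v.
            fps_nth (inverse (denom k ns :: 'a fps)) l) * fps_X ^ (e v + l))
          has_sum (\<Sum>\<^sub>\<infinity>ns\<in>incr_tuples a. fps_X ^ e (w ns) * inverse (denom k ns))) (UNIV \<times> K)"
  proof (rule has_sum_group_by_weight[OF _ K])
    show "finite {ns \<in> incr_tuples a. e (w ns) \<le> i}" for i
      by (rule finite_subset[OF _ finite_incr_tuples_sum_le[of a i]]) (use e order.trans in blast)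
  qed
  then show ?thesis
    by (simp add: poly_sum coeff div cong: infsum_cong)
qed

theorem theorem1p3:
  fixes a :: nat
  assumes "1 \<le> a"
  shows "\<exists>(P :: nat \<Rightarrow> nat \<Rightarrow> 'a::field_char_0 poly) (Q :: nat \<Rightarrow> nat \<Rightarrow> nat \<Rightarrow> 'a poly).
    (\<forall>l n. 1 \<le> n \<longrightarrow> degree (P l n) \<le> l) \<and>
    (\<forall>l m n. 1 \<le> m \<longrightarrow> 1 \<le> n \<longrightarrow> degree (Q l m n) \<le> l) \<and>
    (\<forall>(k::int) (r::nat) (s::nat). 1 \<le> r \<longrightarrow> 1 \<le> s \<longrightarrow>
      ((\<lambda>(l, n). fps_const (poly (P l n) (of_int k)) * fps_X ^ (n * r + l))
        has_sum A_series a k r)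
        {(l, n). a * (a + 1) div 2 \<le> n} \<and>
      ((\<lambda>(l, n, m). fps_const (poly (Q l m n) (of_int k)) * fps_X ^ (m * r + n * s + l))
        has_sum B_series a k r s)
        {(l, n, m). a * (a + 1) div 2 \<le> n \<and> real (n\<^sup>2) / real a \<le> real m \<and> m \<le> n\<^sup>2})"
proof -
  define sq :: "nat list \<Rightarrow> nat" where "sq ns = (\<Sum>n\<leftarrow>ns. n\<^sup>2)" for ns
  \<comment> \<open>Both families are fixed before \<open>k\<close>, \<open>r\<close> and
    \<open>s\<close> appear.\<close>
  define P :: "nat \<Rightarrow> nat \<Rightarrow> 'a poly" where
    "P l n = (\<Sum>ns | ns \<in> incr_tuples a \<and> sum_list ns = n. inv_power_coeff (denom 1 ns) l)" for l n
  define Q :: "nat \<Rightarrow> nat \<Rightarrow> nat \<Rightarrow> 'a poly" where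
    "Q l m n = (\<Sum>ns | ns \<in> incr_tuples a \<and> (sum_list ns, sq ns) = (n, m).
      inv_power_coeff (denom 1 ns) l)" for l m n
  have sq_lower: "real ((sum_list ns)\<^sup>2) / real a \<le> real (sq ns)" if "ns \<in> incr_tuples a" for ns
  proof -
    have "(sum_list ns)\<^sup>2 \<le> a * sq ns"
      using that sum_list_squared_le[of ns] by (simp add: incr_tuples_def sq_def)
    then have "real ((sum_list ns)\<^sup>2) \<le> real a * real (sq ns)"
      by (simp only: flip: of_nat_mult of_nat_le_iff)
    with assms show ?thesis by (simp add: field_simps)
  qed
  have A: "((\<lambda>(l, n). fps_const (poly (P l n) (of_int k)) * fps_X ^ (n * r + l))
      has_sum A_series a k r) {(l, n). a * (a + 1) div 2 \<le> n}" if "1 \<le> r" for k and r :: nat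
  proof -
    have "((\<lambda>(l, n). fps_const (poly (P l n) (of_int k)) * fps_X ^ (n * r + l))
        has_sum (\<Sum>\<^sub>\<infinity>ns\<in>incr_tuples a. fps_X ^ (sum_list ns * r) / denom k ns))
        (UNIV \<times> {n. a * (a + 1) div 2 \<le> n})"
      unfolding P_def
      by (rule has_sum_incr_tuples[where w = sum_list and e = "\<lambda>n. n * r"])
        (use that incr_tuples_sum_lower in auto)
    moreover have "UNIV \<times> {n. a * (a + 1) div 2 \<le> n} = {(l :: nat, n). a * (a + 1) div 2 \<le> n}"
      by auto
    ultimately show ?thesis
      by (simp add: A_series_def A_term_def mult.commute)
  qed
  have B: "((\<lambda>(l, n, m). fps_const (poly (Q l m n) (of_int k)) * fps_X ^ (m * r + n * s + l))
      has_sum B_series a k r s)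
      {(l, n, m). a * (a + 1) div 2 \<le> n \<and> real (n\<^sup>2) / real a \<le> real m \<and> m \<le> n\<^sup>2}"
    if "1 \<le> s" for k and r s :: nat
  proof -
    define K where
      "K = {(n, m). a * (a + 1) div 2 \<le> n \<and> real (n\<^sup>2) / real a \<le> real m \<and> m \<le> n\<^sup>2}"
    \<comment> \<open>The weight records the sum \<open>n\<close> and the sum of squares
      \<open>m\<close>; \<open>e\<close> turns it into the exponent of the numerator.\<close>
    define e where "e = (\<lambda>(n, m). m * r + n * s)"
    define w where "w ns = (sum_list ns, sq ns)" for ns
    have "((\<lambda>(l, v). fps_const (poly (\<Sum>ns | ns \<in> incr_tuples a \<and> w ns = v.
            inv_power_coeff (denom 1 ns) l) (of_int k)) * fps_X ^ (e v + l))
        has_sum (\<Sum>\<^sub>\<infinity>ns\<in>incr_tuples a. fps_X ^ e (w ns) / denom k ns :: 'a fps)) (UNIV \<times> K)"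
    proof (rule has_sum_incr_tuples)
      show "sum_list ns \<le> e (w ns)" for ns
        using that by (simp add: e_def w_def trans_le_add2)
      show "w ` incr_tuples a \<subseteq> K"
        using incr_tuples_sum_lower sq_lower sum_list_squares_le
        by (auto simp: w_def K_def sq_def)
    qed
    moreover have "UNIV \<times> K = {(l :: nat, n, m). a * (a + 1) div 2 \<le> n \<and>
        real (n\<^sup>2) / real a \<le> real m \<and> m \<le> n\<^sup>2}"
      by (auto simp: K_def)
    moreover have "(\<lambda>(l, v). fps_const (poly (\<Sum>ns | ns \<in> incr_tuples a \<and> w ns = v.
          inv_power_coeff (denom 1 ns) l) (of_int k)) * fps_X ^ (e v + l)) =
        (\<lambda>(l, n, m). fps_const (poly (Q l m n) (of_int k)) * fps_X ^ (m * r + n * s + l))"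
      by (auto simp: Q_def w_def e_def)
    moreover have "(\<Sum>\<^sub>\<infinity>ns\<in>incr_tuples a. fps_X ^ e (w ns) / denom k ns :: 'a fps) =
        B_series a k r s"
      by (simp add: B_series_def B_term_def e_def w_def sq_def mult.commute)
    ultimately show ?thesis by simp
  qed
  have "degree (P l n) \<le> l" for l n
    \<comment> \<open>A sum over an infinite set is 0 by convention, so the degree bound holds in
      either case.\<close>
    unfolding P_def by (cases "finite {ns. ns \<in> incr_tuples a \<and> sum_list ns = n}")
      (auto intro: degree_sum_le degree_inv_power_coeff)
  moreover have "degree (Q l m n) \<le> l" for l m n
    unfolding Q_def
    by (cases "finite {ns. ns \<in> incr_tuples a \<and> (sum_list ns, sq ns) = (n, m)}")
      (auto intro: degree_sum_le degree_inv_power_coeff)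
  ultimately show ?thesis using A B by blast
qed

end
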